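(* Let $G$ be the group given by the following presentation. Generators: $e_i,a_i,b_i$ for $i\in\{0,1,2,3\}$, and $u_{ij},v_{ij},w_{ij}$ for $0\le i<j\le3$. Write $y_i=[a_i,b_i]$ and $y_{ij}=[[u_{ij},v_{ij}],w_{ij}]$. Relations: $$e_i^{3^{2i}}=y_i\ \text{ for } i\in\{0,1,2,3\},$$ $$e_j^{3^{12-i}}e_i^{3^{12-j}}=y_{ij}^{3^{12-2i-2j}}\ \text{ for }(i,j)\in\{(0,1),(0,2),(1,3),(2,3)\}.$$ Let $\omega=[[e_2,e_1],e_0]^{3^9}\in G$. Then $\omega\in\delta_7(G)$.
   Context: Commutators are $[g,h]=g^{-1}h^{-1}gh$. For a group $G$, $\varpi$ is the augmentation ideal of the integral group ring $\mathbb Z G$, and $\delta_n(G)=\{g\in G:g-1\in\varpi^n\}$ is the $n$th dimension subgroup. *)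

theory Defs
  imports
    "HOL-Algebra.Generated_Groups"
    "HOL-Algebra.Free_Abelian_Groups"
    "HOL-Algebra.Ideal_Product"
begin

section \<open>Free groups and presentations\<close>

text \<open>
  A letter \<open>(x, True)\<close> stands for the generator \<open>x\<close> and \<open>(x, False)\<close> for its formal inverse.
\<close>

type_synonym 'g word = "('g \<times> bool) list"

definition words :: "'g set \<Rightarrow> 'g word set"
  where "words S = lists (S \<times> UNIV)"

inductive_set free_rel :: "'g set \<Rightarrow> ('g word \<times> 'g word) set" for S
  where
    refl: "w \<in> words S \<Longrightarrow> (w, w) \<in> free_rel S"
  | sym: "(v, w) \<in> free_rel S \<Longrightarrow> (w, v) \<in> free_rel S"
  | trans: "(u, v) \<in> free_rel S \<Longrightarrow> (v, w) \<in> free_rel S \<Longrightarrow> (u, w) \<in> free_rel S"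
  | cancel: "u \<in> words S \<Longrightarrow> v \<in> words S \<Longrightarrow> x \<in> S \<Longrightarrow>
      (u @ [(x, b), (x, \<not> b)] @ v, u @ v) \<in> free_rel S"

definition free_group :: "'g set \<Rightarrow> 'g word set monoid"
  where "free_group S =
    \<lparr>carrier = words S // free_rel S,
     monoid.mult = (\<lambda>A B. \<Union>u\<in>A. \<Union>v\<in>B. free_rel S `` {u @ v}),
     one = free_rel S `` {[]}\<rparr>"

definition free_gen :: "'g set \<Rightarrow> 'g \<Rightarrow> 'g word set"
  where "free_gen S x = free_rel S `` {[(x, True)]}"

definition normal_closure :: "('a, 'b) monoid_scheme \<Rightarrow> 'a set \<Rightarrow> 'a set"
  where "normal_closure G X =
    generate G {g \<otimes>\<^bsub>G\<^esub> x \<otimes>\<^bsub>G\<^esub> inv\<^bsub>G\<^esub> g | g x. g \<in> carrier G \<and> x \<in> X}"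

text \<open>
  A presentation has a set \<open>S\<close> of generators and a set \<open>R\<close> of pairs of elements of the free group
  on \<open>S\<close>; the pair \<open>(l, r)\<close> stands for the relation \<open>l = r\<close>.
\<close>

definition relators :: "'g set \<Rightarrow> ('g word set \<times> 'g word set) set \<Rightarrow> 'g word set set"
  where "relators S R = {l \<otimes>\<^bsub>free_group S\<^esub> inv\<^bsub>free_group S\<^esub> r | l r. (l, r) \<in> R}"

definition presented_group ::
    "'g set \<Rightarrow> ('g word set \<times> 'g word set) set \<Rightarrow> 'g word set set monoid"
  where "presented_group S R = free_group S Mod normal_closure (free_group S) (relators S R)"

definition presented_gen ::
    "'g set \<Rightarrow> ('g word set \<times> 'g word set) set \<Rightarrow> 'g \<Rightarrow> 'g word set set"
  where "presented_gen S R x =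
    normal_closure (free_group S) (relators S R) #>\<^bsub>free_group S\<^esub> free_gen S x"


section \<open>Commutators and dimension subgroups\<close>

definition commutator :: "('a, 'b) monoid_scheme \<Rightarrow> 'a \<Rightarrow> 'a \<Rightarrow> 'a"
  where "commutator G g h = inv\<^bsub>G\<^esub> g \<otimes>\<^bsub>G\<^esub> inv\<^bsub>G\<^esub> h \<otimes>\<^bsub>G\<^esub> g \<otimes>\<^bsub>G\<^esub> h"

text \<open>
  The additive group of the integral group ring is the free abelian group on \<open>carrier G\<close>; the
  product is the \<open>\<int>\<close>-bilinear extension of the product of \<open>G\<close>.
\<close>

definition group_ring :: "('a, 'b) monoid_scheme \<Rightarrow> ('a \<Rightarrow>\<^sub>0 int) ring"
  where "group_ring G =
    \<lparr>carrier = carrier (free_Abelian_group (carrier G)),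
     monoid.mult = (\<lambda>x y. frag_extend (\<lambda>g. frag_extend (\<lambda>h. frag_of (g \<otimes>\<^bsub>G\<^esub> h)) y) x),
     one = frag_of \<one>\<^bsub>G\<^esub>,
     zero = 0,
     add = (+)\<rparr>"

definition augmentation :: "('a \<Rightarrow>\<^sub>0 int) \<Rightarrow> int"
  where "augmentation x = (\<Sum>g\<in>Poly_Mapping.keys x. Poly_Mapping.lookup x g)"

definition augmentation_ideal :: "('a, 'b) monoid_scheme \<Rightarrow> ('a \<Rightarrow>\<^sub>0 int) set"
  where "augmentation_ideal G = {x \<in> carrier (group_ring G). augmentation x = 0}"

text \<open>
  The power below is taken in the multiplicative structure of \<open>ideals_set\<close>, where the product is
  \<open>ideal_prod\<close>; so \<open>I [^] n\<close> is the ideal power \<open>I\<^sup>n\<close>, with \<open>I [^] 0\<close> the whole ring.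
\<close>

definition dimension_subgroup :: "nat \<Rightarrow> ('a, 'b) monoid_scheme \<Rightarrow> 'a set"
  where "dimension_subgroup n G =
    {g \<in> carrier G. frag_of g \<ominus>\<^bsub>group_ring G\<^esub> \<one>\<^bsub>group_ring G\<^esub>
       \<in> augmentation_ideal G [^]\<^bsub>ideals_set (group_ring G)\<^esub> n}"


section \<open>The presentation\<close>

datatype generator = E nat | A nat | B nat | U nat nat | V nat nat | W nat nat

definition gens :: "generator set"
  where "gens =
    {E i | i. i \<le> 3} \<union> {A i | i. i \<le> 3} \<union> {B i | i. i \<le> 3} \<union>
    {U i j | i j. i < j \<and> j \<le> 3} \<union> {V i j | i j. i < j \<and> j \<le> 3} \<union>
    {W i j | i j. i < j \<and> j \<le> 3}"

definition rels :: "(generator word set \<times> generator word set) set"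
  where "rels =
    (let F = free_group gens;
         e = (\<lambda>i. free_gen gens (E i));
         a = (\<lambda>i. free_gen gens (A i));
         b = (\<lambda>i. free_gen gens (B i));
         u = (\<lambda>i j. free_gen gens (U i j));
         v = (\<lambda>i j. free_gen gens (V i j));
         w = (\<lambda>i j. free_gen gens (W i j));
         y = (\<lambda>i. commutator F (a i) (b i));
         yy = (\<lambda>i j. commutator F (commutator F (u i j) (v i j)) (w i j))
     in {(e i [^]\<^bsub>F\<^esub> ((3::nat) ^ (2 * i)), y i) | i. i \<in> {0, 1, 2, 3}} \<union>
        {(e j [^]\<^bsub>F\<^esub> ((3::nat) ^ (12 - i)) \<otimes>\<^bsub>F\<^esub> e i [^]\<^bsub>F\<^esub> ((3::nat) ^ (12 - j)),
          yy i j [^]\<^bsub>F\<^esub> ((3::nat) ^ (12 - 2 * i - 2 * j))) | i j.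
          (i, j) \<in> {(0, 1), (0, 2), (1, 3), (2, 3)}})"


section \<open>Basic facts\<close>

lemma words_simps [simp]:
  "[] \<in> words S" "(x, b) # w \<in> words S \<longleftrightarrow> x \<in> S \<and> w \<in> words S"
  "u @ v \<in> words S \<longleftrightarrow> u \<in> words S \<and> v \<in> words S"
  by (auto simp: words_def)

lemma free_rel_words:
  assumes "(u, v) \<in> free_rel S"
  shows "u \<in> words S \<and> v \<in> words S"
  using assms by induction auto

lemma equiv_free_rel: "equiv (words S) (free_rel S)"
  by (rule equivI)
     (auto simp: refl_on_def sym_def trans_def dest: free_rel_words intro: free_rel.intros)

lemma free_rel_append_right:
  assumes "(u, v) \<in> free_rel S" "w \<in> words S"
  shows "(u @ w, v @ w) \<in> free_rel S"
  using assms
proof induction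
  case (cancel u v x b)
  then show ?case using free_rel.cancel[of u S "v @ w" x b] by simp
qed (auto intro: free_rel.intros)

lemma free_rel_append_left:
  assumes "(u, v) \<in> free_rel S" "w \<in> words S"
  shows "(w @ u, w @ v) \<in> free_rel S"
  using assms
proof induction
  case (cancel u v x b)
  then show ?case using free_rel.cancel[of "w @ u" S v x b] by simp
qed (auto intro: free_rel.intros)

lemma free_rel_append:
  assumes "(u, u') \<in> free_rel S" "(v, v') \<in> free_rel S"
  shows "(u @ v, u' @ v') \<in> free_rel S"
  using assms free_rel_append_left free_rel_append_right free_rel_words free_rel.trans by metis

lemma free_group_mult_class:
  assumes "u \<in> words S" "v \<in> words S"
  shows "free_rel S `` {u} \<otimes>\<^bsub>free_group S\<^esub> free_rel S `` {v} = free_rel S `` {u @ v}"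
proof -
  have "(\<Union>u'\<in>free_rel S `` {u}. \<Union>v'\<in>free_rel S `` {v}. free_rel S `` {u' @ v'})
      = free_rel S `` {u @ v}"
    using assms by (auto intro: free_rel.intros free_rel_append dest: free_rel_words)
  then show ?thesis by (simp add: free_group_def)
qed

lemma free_group_carrierE:
  assumes "X \<in> carrier (free_group S)"
  obtains w where "w \<in> words S" "X = free_rel S `` {w}"
  using assms by (auto simp: free_group_def quotient_def)

lemma free_class_closed: "w \<in> words S \<Longrightarrow> free_rel S `` {w} \<in> carrier (free_group S)"
  by (auto simp: free_group_def quotient_def)

lemma free_rel_inverse:
  assumes "w \<in> words S"
  shows "(rev (map (\<lambda>(x, b). (x, \<not> b)) w) @ w, []) \<in> free_rel S
         \<and> rev (map (\<lambda>(x, b). (x, \<not> b)) w) \<in> words S"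
  using assms
proof (induction w)
  case (Cons p w)
  obtain x b where p: "p = (x, b)" by force
  let ?w' = "rev (map (\<lambda>(x, b). (x, \<not> b)) w)"
  have "(?w' @ [(x, \<not> b), (x, \<not> \<not> b)] @ w, ?w' @ w) \<in> free_rel S"
    using Cons p by (intro free_rel.cancel) auto
  then show ?case using Cons p by (auto intro: free_rel.trans)
qed (auto intro: free_rel.refl)

lemma group_free_group: "group (free_group S)"
proof (rule groupI)
  have one: "\<one>\<^bsub>free_group S\<^esub> = free_rel S `` {[]}" by (simp add: free_group_def)
  show "\<one>\<^bsub>free_group S\<^esub> \<in> carrier (free_group S)" by (simp add: one free_class_closed)
  fix x assume "x \<in> carrier (free_group S)"
  then obtain u where u: "u \<in> words S" "x = free_rel S `` {u}" by (rule free_group_carrierE)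
  show "\<one>\<^bsub>free_group S\<^esub> \<otimes>\<^bsub>free_group S\<^esub> x = x" by (simp add: u one free_group_mult_class)
  show "\<exists>y\<in>carrier (free_group S). y \<otimes>\<^bsub>free_group S\<^esub> x = \<one>\<^bsub>free_group S\<^esub>"
    using free_rel_inverse[OF u(1)] u one free_class_closed free_group_mult_class
      equiv_class_eq[OF equiv_free_rel] by metis
  fix y assume "y \<in> carrier (free_group S)"
  then obtain v where v: "v \<in> words S" "y = free_rel S `` {v}" by (rule free_group_carrierE)
  show "x \<otimes>\<^bsub>free_group S\<^esub> y \<in> carrier (free_group S)"
    by (simp add: u v free_group_mult_class free_class_closed)
  fix z assume "z \<in> carrier (free_group S)"
  then obtain w where w: "w \<in> words S" "z = free_rel S `` {w}" by (rule free_group_carrierE)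
  show "x \<otimes>\<^bsub>free_group S\<^esub> y \<otimes>\<^bsub>free_group S\<^esub> z = x \<otimes>\<^bsub>free_group S\<^esub> (y \<otimes>\<^bsub>free_group S\<^esub> z)"
    by (simp add: u v w free_group_mult_class)
qed

lemma free_gen_closed: "x \<in> S \<Longrightarrow> free_gen S x \<in> carrier (free_group S)"
  by (simp add: free_gen_def free_class_closed)

lemma normal_normal_closure:
  assumes "group G" "X \<subseteq> carrier G"
  shows "normal_closure G X \<lhd> G"
proof -
  interpret group G by fact
  show ?thesis unfolding normal_closure_def
  proof (rule normal_generateI)
    fix h g
    assume "h \<in> {g \<otimes>\<^bsub>G\<^esub> x \<otimes>\<^bsub>G\<^esub> inv\<^bsub>G\<^esub> g | g x. g \<in> carrier G \<and> x \<in> X}" and g: "g \<in> carrier G"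
    then obtain k x where *: "h = k \<otimes>\<^bsub>G\<^esub> x \<otimes>\<^bsub>G\<^esub> inv\<^bsub>G\<^esub> k" "k \<in> carrier G" "x \<in> X" by blast
    then have "g \<otimes>\<^bsub>G\<^esub> h \<otimes>\<^bsub>G\<^esub> inv\<^bsub>G\<^esub> g = (g \<otimes>\<^bsub>G\<^esub> k) \<otimes>\<^bsub>G\<^esub> x \<otimes>\<^bsub>G\<^esub> inv\<^bsub>G\<^esub> (g \<otimes>\<^bsub>G\<^esub> k)"
      using assms g by (auto simp: inv_mult_group m_assoc subset_iff)
    then show "g \<otimes>\<^bsub>G\<^esub> h \<otimes>\<^bsub>G\<^esub> inv\<^bsub>G\<^esub> g
        \<in> {g \<otimes>\<^bsub>G\<^esub> x \<otimes>\<^bsub>G\<^esub> inv\<^bsub>G\<^esub> g | g x. g \<in> carrier G \<and> x \<in> X}"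
      using * g by blast
  qed (use assms in auto)
qed

lemma normal_closure_incl:
  assumes "group G" "X \<subseteq> carrier G" "x \<in> X"
  shows "x \<in> normal_closure G X"
proof -
  interpret group G by fact
  have "x = \<one>\<^bsub>G\<^esub> \<otimes>\<^bsub>G\<^esub> x \<otimes>\<^bsub>G\<^esub> inv\<^bsub>G\<^esub> \<one>\<^bsub>G\<^esub>" using assms by auto
  then show ?thesis using assms unfolding normal_closure_def
    by (intro generate.incl) blast
qed

lemma relators_closed:
  assumes "R \<subseteq> carrier (free_group S) \<times> carrier (free_group S)"
  shows "relators S R \<subseteq> carrier (free_group S)"
proof -
  interpret group "free_group S" by (rule group_free_group)
  show ?thesis using assms by (auto simp: relators_def)
qed

lemma group_presented_group:
  assumes "R \<subseteq> carrier (free_group S) \<times> carrier (free_group S)"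
  shows "group (presented_group S R)"
  unfolding presented_group_def
  by (intro normal.factorgroup_is_group normal_normal_closure group_free_group
      relators_closed assms)

lemma presented_group_relation:
  assumes R: "R \<subseteq> carrier (free_group S) \<times> carrier (free_group S)" and lr: "(l, r) \<in> R"
  shows "normal_closure (free_group S) (relators S R) #>\<^bsub>free_group S\<^esub> l
       = normal_closure (free_group S) (relators S R) #>\<^bsub>free_group S\<^esub> r"
proof -
  let ?F = "free_group S" and ?N = "normal_closure (free_group S) (relators S R)"
  interpret group ?F by (rule group_free_group)
  interpret N: normal ?N ?F by (intro normal_normal_closure group_free_group relators_closed R)
  have c: "l \<in> carrier ?F" "r \<in> carrier ?F" using assms by auto
  have "l \<otimes>\<^bsub>?F\<^esub> inv\<^bsub>?F\<^esub> r \<in> ?N"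
    using lr by (intro normal_closure_incl group_free_group relators_closed R)
      (auto simp: relators_def)
  then have "(l \<otimes>\<^bsub>?F\<^esub> inv\<^bsub>?F\<^esub> r) \<otimes>\<^bsub>?F\<^esub> r \<in> ?N #>\<^bsub>?F\<^esub> r"
    by (auto simp: r_coset_def)
  then have "l \<in> ?N #>\<^bsub>?F\<^esub> r" using c by (simp add: m_assoc)
  then show ?thesis using repr_independence N.subgroup_axioms c by metis
qed

lemma free_group_universal:
  assumes H: "group H" and f: "f \<in> S \<rightarrow> carrier H"
  shows "\<exists>h\<in>hom (free_group S) H. \<forall>x\<in>S. h (free_gen S x) = f x"
proof -
  interpret H: group H by fact
  define ev where "ev = (\<lambda>w. foldr (\<lambda>(x, b) z. (if b then f x else inv\<^bsub>H\<^esub> f x) \<otimes>\<^bsub>H\<^esub> z) w \<one>\<^bsub>H\<^esub>)"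
  have ev_simps: "ev [] = \<one>\<^bsub>H\<^esub>"
    "ev ((x, b) # w) = (if b then f x else inv\<^bsub>H\<^esub> f x) \<otimes>\<^bsub>H\<^esub> ev w" for x b w
    by (simp_all add: ev_def)
  have fc: "f x \<in> carrier H" if "x \<in> S" for x using f that by auto
  have evc: "ev w \<in> carrier H" if "w \<in> words S" for w
    using that by (induction w) (auto simp: ev_simps fc)
  have app: "ev (u @ v) = ev u \<otimes>\<^bsub>H\<^esub> ev v" if "u \<in> words S" "v \<in> words S" for u v
    using that by (induction u) (auto simp: ev_simps fc evc H.m_assoc)
  have resp: "ev u = ev v" if "(u, v) \<in> free_rel S" for u v
    using that
  proof induction
    case (cancel u v x b)
    have "ev ([(x, b), (x, \<not> b)] @ v) = ev v"
      using cancel by (auto simp: ev_simps fc evc H.m_assoc[symmetric])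
    then show ?case using cancel by (simp add: app)
  qed auto
  define h where "h = (\<lambda>X. ev (SOME w. w \<in> X))"
  have h: "h (free_rel S `` {w}) = ev w" if "w \<in> words S" for w
  proof -
    have "(SOME v. v \<in> free_rel S `` {w}) \<in> free_rel S `` {w}"
      using that by (metis Image_singleton_iff free_rel.refl someI_ex)
    then show ?thesis using resp by (auto simp: h_def)
  qed
  have "h \<in> hom (free_group S) H"
    by (rule homI) (auto elim!: free_group_carrierE simp: h evc free_group_mult_class app)
  moreover have "h (free_gen S x) = f x" if "x \<in> S" for x
    using that by (simp add: free_gen_def h ev_simps fc)
  ultimately show ?thesis by blast
qed

lemma presented_group_universal:
  assumes R: "R \<subseteq> carrier (free_group S) \<times> carrier (free_group S)"
    and H: "group H" and h: "h \<in> hom (free_group S) H" and eq: "\<And>l r. (l, r) \<in> R \<Longrightarrow> h l = h r"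
  shows "\<exists>k\<in>hom (presented_group S R) H. \<forall>x\<in>S. k (presented_gen S R x) = h (free_gen S x)"
proof -
  let ?F = "free_group S" and ?N = "normal_closure (free_group S) (relators S R)"
  interpret group_hom ?F H h
    using group_free_group H h by (simp add: group_hom_def group_hom_axioms_def)
  have N: "?N \<lhd> ?F" by (intro normal_normal_closure group_free_group relators_closed R)
  interpret N: normal ?N ?F by (rule N)
  have "?N \<subseteq> kernel ?F H h"
    unfolding normal_closure_def
  proof (rule G.generate_subgroup_incl)
    show "subgroup (kernel ?F H h) ?F" by (rule subgroup_kernel)
    show "{g \<otimes>\<^bsub>?F\<^esub> x \<otimes>\<^bsub>?F\<^esub> inv\<^bsub>?F\<^esub> g | g x. g \<in> carrier ?F \<and> x \<in> relators S R} \<subseteq> kernel ?F H h"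
      using R by (auto simp: kernel_def relators_def eq)
  qed
  then have ker: "h n = \<one>\<^bsub>H\<^esub>" if "n \<in> ?N" for n using that by (auto simp: kernel_def)
  obtain k where "k \<in> hom (?F Mod ?N) H" "\<And>x. x \<in> carrier ?F \<Longrightarrow> k (?N #>\<^bsub>?F\<^esub> x) = h x"
  proof (rule FactGroup_universal[OF h N])
    fix x y assume c: "x \<in> carrier ?F" "y \<in> carrier ?F" and "?N #>\<^bsub>?F\<^esub> x = ?N #>\<^bsub>?F\<^esub> y"
    then have "x \<in> ?N #>\<^bsub>?F\<^esub> y" using G.rcos_self[OF c(1) N.subgroup_axioms] by simp
    then obtain n where "n \<in> ?N" "x = n \<otimes>\<^bsub>?F\<^esub> y" by (auto simp: r_coset_def)
    then show "h x = h y" using c N.subset by (auto simp: ker)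
  qed blast
  then show ?thesis
    unfolding presented_group_def presented_gen_def by (auto intro!: bexI[of _ k] simp: free_gen_closed)
qed

lemma keys_group_ring_mult:
  assumes "group G" "Poly_Mapping.keys x \<subseteq> carrier G" "Poly_Mapping.keys y \<subseteq> carrier G"
  shows "Poly_Mapping.keys (x \<otimes>\<^bsub>group_ring G\<^esub> y) \<subseteq> carrier G"
proof -
  interpret group G by fact
  have "Poly_Mapping.keys (frag_extend (\<lambda>h. frag_of (g \<otimes>\<^bsub>G\<^esub> h)) y) \<subseteq> carrier G"
    if "g \<in> carrier G" for g
    using that assms by (intro order_trans[OF keys_frag_extend]) auto
  then show ?thesis using assms
    by (simp add: group_ring_def) (intro order_trans[OF keys_frag_extend], auto)
qed

lemma group_ring_mult_of:
  "frag_of g \<otimes>\<^bsub>group_ring G\<^esub> frag_of h = frag_of (g \<otimes>\<^bsub>G\<^esub> h)"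
  by (simp add: group_ring_def)

lemma group_ring_mult_diff:
  "(x - x') \<otimes>\<^bsub>group_ring G\<^esub> y = x \<otimes>\<^bsub>group_ring G\<^esub> y - x' \<otimes>\<^bsub>group_ring G\<^esub> y"
  "x \<otimes>\<^bsub>group_ring G\<^esub> (y - y') = x \<otimes>\<^bsub>group_ring G\<^esub> y - x \<otimes>\<^bsub>group_ring G\<^esub> y'"
  "0 \<otimes>\<^bsub>group_ring G\<^esub> y = 0" "x \<otimes>\<^bsub>group_ring G\<^esub> 0 = 0"
proof -
  have dist: "frag_cmul c (a - b) = frag_cmul c a - frag_cmul c b" for c and a b :: "'a \<Rightarrow>\<^sub>0 int"
    by (rule poly_mapping_eqI) (simp add: lookup_minus right_diff_distrib)
  have eq: "frag_extend (\<lambda>g. p g - q g) x = frag_extend p x - frag_extend q x"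
    for p q :: "'a \<Rightarrow> 'a \<Rightarrow>\<^sub>0 int"
    by (simp add: frag_extend_def dist sum_subtractf)
  show "(x - x') \<otimes>\<^bsub>group_ring G\<^esub> y = x \<otimes>\<^bsub>group_ring G\<^esub> y - x' \<otimes>\<^bsub>group_ring G\<^esub> y"
    "x \<otimes>\<^bsub>group_ring G\<^esub> (y - y') = x \<otimes>\<^bsub>group_ring G\<^esub> y - x \<otimes>\<^bsub>group_ring G\<^esub> y'"
    "0 \<otimes>\<^bsub>group_ring G\<^esub> y = 0" "x \<otimes>\<^bsub>group_ring G\<^esub> 0 = 0"
    by (simp_all add: group_ring_def frag_extend_diff eq frag_extend_eq_0)
qed

lemma ring_group_ring:
  assumes "group G"
  shows "ring (group_ring G)"
proof -
  interpret group G by fact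
  let ?R = "group_ring G"
  have carr: "carrier ?R = {x. Poly_Mapping.keys x \<subseteq> carrier G}"
    by (simp add: group_ring_def free_Abelian_group_def)
  have add: "x \<oplus>\<^bsub>?R\<^esub> y = x + y" "\<zero>\<^bsub>?R\<^esub> = 0" "\<one>\<^bsub>?R\<^esub> = frag_of \<one>\<^bsub>G\<^esub>" for x y
    by (simp_all add: group_ring_def)
  have madd: "(x + x') \<otimes>\<^bsub>?R\<^esub> y = x \<otimes>\<^bsub>?R\<^esub> y + x' \<otimes>\<^bsub>?R\<^esub> y"
    "x \<otimes>\<^bsub>?R\<^esub> (y + y') = x \<otimes>\<^bsub>?R\<^esub> y + x \<otimes>\<^bsub>?R\<^esub> y'" for x x' y y'
    using group_ring_mult_diff(1)[of G x "- x'" y] group_ring_mult_diff(1)[of G 0 x' y]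
      group_ring_mult_diff(2)[of G x y "- y'"] group_ring_mult_diff(2)[of G x 0 y']
    by (simp_all add: group_ring_mult_diff(3,4))
  note closed = keys_group_ring_mult[OF assms]
  have left: "x \<otimes>\<^bsub>?R\<^esub> frag_of \<one>\<^bsub>G\<^esub> = x" "frag_of \<one>\<^bsub>G\<^esub> \<otimes>\<^bsub>?R\<^esub> x = x"
    if "Poly_Mapping.keys x \<subseteq> carrier G" for x
    using that by (induction rule: frag_induction)
      (simp_all add: group_ring_mult_diff group_ring_mult_of)
  have assoc1: "(frag_of g \<otimes>\<^bsub>?R\<^esub> frag_of h) \<otimes>\<^bsub>?R\<^esub> z = frag_of g \<otimes>\<^bsub>?R\<^esub> (frag_of h \<otimes>\<^bsub>?R\<^esub> z)"
    if "Poly_Mapping.keys z \<subseteq> carrier G" "g \<in> carrier G" "h \<in> carrier G" for g h z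
    using that by (induction rule: frag_induction)
      (simp_all add: group_ring_mult_diff group_ring_mult_of m_assoc)
  have assoc2: "(frag_of g \<otimes>\<^bsub>?R\<^esub> y) \<otimes>\<^bsub>?R\<^esub> z = frag_of g \<otimes>\<^bsub>?R\<^esub> (y \<otimes>\<^bsub>?R\<^esub> z)"
    if "Poly_Mapping.keys y \<subseteq> carrier G" "Poly_Mapping.keys z \<subseteq> carrier G" "g \<in> carrier G" for g y z
    using that by (induction rule: frag_induction) (simp_all add: group_ring_mult_diff assoc1)
  have assoc: "(x \<otimes>\<^bsub>?R\<^esub> y) \<otimes>\<^bsub>?R\<^esub> z = x \<otimes>\<^bsub>?R\<^esub> (y \<otimes>\<^bsub>?R\<^esub> z)"
    if "Poly_Mapping.keys x \<subseteq> carrier G" "Poly_Mapping.keys y \<subseteq> carrier G"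
      "Poly_Mapping.keys z \<subseteq> carrier G" for x y z
    using that by (induction rule: frag_induction) (simp_all add: group_ring_mult_diff assoc2)
  show ?thesis
  proof (rule ringI)
    show "abelian_group ?R"
    proof (rule abelian_groupI)
      show "\<exists>y\<in>carrier ?R. y \<oplus>\<^bsub>?R\<^esub> x = \<zero>\<^bsub>?R\<^esub>" if "x \<in> carrier ?R" for x
        using that by (intro bexI[of _ "- x"]) (auto simp: carr add)
    qed (auto simp: carr add algebra_simps dest: subsetD[OF keys_add])
    show "monoid ?R"
      by (rule monoidI) (simp_all add: carr add closed left assoc)
  qed (simp_all add: add madd)
qed

lemma group_ring_minus:
  assumes "group G" "x \<in> carrier (group_ring G)" "y \<in> carrier (group_ring G)"
  shows "x \<ominus>\<^bsub>group_ring G\<^esub> y = x - y"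
proof -
  interpret ring "group_ring G" by (rule ring_group_ring) fact
  have "- y \<in> carrier (group_ring G)" "y \<oplus>\<^bsub>group_ring G\<^esub> (- y) = \<zero>\<^bsub>group_ring G\<^esub>"
    using assms by (simp_all add: group_ring_def)
  then have "\<ominus>\<^bsub>group_ring G\<^esub> y = - y"
    using assms by (metis add.inv_equality a_comm)
  then show ?thesis by (simp add: a_minus_def) (simp add: group_ring_def)
qed

lemma ideal_augmentation_ideal:
  assumes "group G"
  shows "ideal (augmentation_ideal G) (group_ring G)"
proof -
  interpret group G by fact
  interpret R: ring "group_ring G" by (rule ring_group_ring) fact
  let ?R = "group_ring G"
  have carr: "carrier ?R = {x. Poly_Mapping.keys x \<subseteq> carrier G}"
    by (simp add: group_ring_def free_Abelian_group_def)
  have eps: "augmentation x = Poly_Mapping.lookup (frag_extend (\<lambda>_. frag_of ()) x) ()"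
    for x :: "'a \<Rightarrow>\<^sub>0 int"
    unfolding augmentation_def frag_extend_def by (induction rule: infinite_finite_induct)
      (simp_all add: lookup_add)
  have diff: "augmentation (x - y) = augmentation x - augmentation y" for x y :: "'a \<Rightarrow>\<^sub>0 int"
    by (simp add: eps frag_extend_diff lookup_minus)
  have add: "augmentation (x + y) = augmentation x + augmentation y" for x y :: "'a \<Rightarrow>\<^sub>0 int"
    by (simp add: eps frag_extend_add lookup_add)
  have of: "augmentation (frag_of g) = 1" "augmentation 0 = 0" for g :: 'a
    by (simp_all add: augmentation_def)
  have mult1: "augmentation (frag_of g \<otimes>\<^bsub>?R\<^esub> y) = augmentation y" for g y
    using subset_UNIV[of "Poly_Mapping.keys y"] by (induction rule: frag_induction)
      (simp_all add: group_ring_mult_diff group_ring_mult_of diff of)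
  have mult: "augmentation (x \<otimes>\<^bsub>?R\<^esub> y) = augmentation x * augmentation y" for x y
    using subset_UNIV[of "Poly_Mapping.keys x"] by (induction rule: frag_induction)
      (simp_all add: group_ring_mult_diff mult1 diff of left_diff_distrib)
  have minus: "\<ominus>\<^bsub>?R\<^esub> x = - x" if "x \<in> carrier ?R" for x
    using group_ring_minus[OF assms R.zero_closed that] R.minus_eq[of "\<zero>\<^bsub>?R\<^esub>" x] that
    by (simp add: group_ring_def)
  show ?thesis
  proof (rule idealI)
    show "ring ?R" by (rule R.ring_axioms)
    show "subgroup (augmentation_ideal G) (add_monoid ?R)"
    proof (rule R.add.subgroupI)
      show "augmentation_ideal G \<subseteq> carrier ?R" by (auto simp: augmentation_ideal_def)
      show "augmentation_ideal G \<noteq> {}"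
        using R.zero_closed by (auto simp: augmentation_ideal_def of group_ring_def intro!: exI[of _ 0])
      show "\<ominus>\<^bsub>?R\<^esub> x \<in> augmentation_ideal G" if "x \<in> augmentation_ideal G" for x
        using that minus[of x] diff[of 0 x] R.a_inv_closed[of x]
        by (simp add: augmentation_ideal_def of)
      show "x \<oplus>\<^bsub>?R\<^esub> y \<in> augmentation_ideal G"
        if "x \<in> augmentation_ideal G" "y \<in> augmentation_ideal G" for x y
        using that R.a_closed[of x y] add[of x y]
        by (simp add: augmentation_ideal_def) (simp add: group_ring_def)
    qed
  qed (simp_all add: augmentation_ideal_def mult)
qed

lemma commutator_closed:
  "group G \<Longrightarrow> g \<in> carrier G \<Longrightarrow> h \<in> carrier G \<Longrightarrow> commutator G g h \<in> carrier G"
  by (simp add: commutator_def group.is_monoid monoid.m_closed group.inv_closed)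

lemma rels_closed: "rels \<subseteq> carrier (free_group gens) \<times> carrier (free_group gens)"
proof
  interpret group "free_group gens" by (rule group_free_group)
  have gen1: "E i \<in> gens" "A i \<in> gens" "B i \<in> gens" if "i \<le> 3" for i
    using that by (auto simp: gens_def)
  have gen2: "U i j \<in> gens" "V i j \<in> gens" "W i j \<in> gens" if "i < j" "j \<le> 3" for i j
    using that by (auto simp: gens_def)
  note closed = SigmaI nat_pow_closed m_closed commutator_closed free_gen_closed group_free_group
  fix p assume "p \<in> rels"
  then show "p \<in> carrier (free_group gens) \<times> carrier (free_group gens)"
    unfolding rels_def Let_def
  proof (elim UnE CollectE exE conjE)
    fix i :: nat assume "i \<in> {0, 1, 2, 3}"
    then have "i \<le> 3" by (elim insertE emptyE) simp_all
    assume "p = (free_gen gens (E i) [^]\<^bsub>free_group gens\<^esub> ((3::nat) ^ (2 * i)),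
        commutator (free_group gens) (free_gen gens (A i)) (free_gen gens (B i)))"
    then show ?thesis
      by (rule ssubst) (intro closed gen1 \<open>i \<le> 3\<close>)
  next
    fix i j :: nat assume "(i, j) \<in> {(0, 1), (0, 2), (1, 3), (2, 3)}"
    then have ij: "i < j" "j \<le> 3" "i \<le> 3" by auto
    assume "p = (free_gen gens (E j) [^]\<^bsub>free_group gens\<^esub> ((3::nat) ^ (12 - i))
          \<otimes>\<^bsub>free_group gens\<^esub> free_gen gens (E i) [^]\<^bsub>free_group gens\<^esub> ((3::nat) ^ (12 - j)),
        commutator (free_group gens)
          (commutator (free_group gens) (free_gen gens (U i j)) (free_gen gens (V i j)))
          (free_gen gens (W i j)) [^]\<^bsub>free_group gens\<^esub> ((3::nat) ^ (12 - 2 * i - 2 * j)))"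
    then show ?thesis
      by (rule ssubst) (intro closed gen1 gen2 ij)
  qed
qed

end

theory Submission
  imports Defs
begin

text \<open>
  Write \<open>x\<^sub>i = e\<^sub>i - 1\<close>. The relation \<open>e\<^sub>i ^ 3^(2i) = [a\<^sub>i, b\<^sub>i]\<close> puts \<open>3^(2i) x\<^sub>i\<close> into \<open>\<varpi>\<^sup>2\<close>: powers of
  \<open>3\<close> can be traded for depth in the augmentation filtration. The four remaining relations have
  the shape \<open>e\<^sub>j ^ 3^(12-i) e\<^sub>i ^ 3^(12-j) = y ^ 3^(12-2i-2j)\<close> with \<open>y - 1 \<in> \<varpi>\<^sup>3\<close>. Put
  \<open>f\<^sub>i = 3^i x\<^sub>i\<close> and let \<open>{k, l}\<close> be the complement of \<open>{i, j}\<close> in \<open>{0, 1, 2, 3}\<close>. As \<open>i + j + k + l = 6\<close>,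
  the exponent \<open>12 - 2i - 2j\<close> is \<open>2k + 2l\<close>, exactly what is needed to put
  \<open>x\<^sub>k\<close> and \<open>x\<^sub>l\<close> both into \<open>\<varpi>\<^sup>2\<close>. Multiplying the linear part of the relation by \<open>x\<^sub>k\<close> and \<open>x\<^sub>l\<close>
  therefore gives \<open>3^6 (f\<^sub>i + f\<^sub>j) f\<^sub>k f\<^sub>l \<in> \<varpi>\<^sup>7\<close>, and likewise with \<open>f\<^sub>i + f\<^sub>j\<close> in the middle or last
  position (\<open>word_slide\<close>). The group relation differs from its linear part by higher binomial
  terms and a cross term; the powers of \<open>3\<close> at hand suffice to push these into \<open>\<varpi>\<^sup>7\<close> too
  (\<open>slot_relation\<close>).

  So modulo \<open>\<varpi>\<^sup>7\<close> a letter of a word \<open>3^6 f\<^sub>a f\<^sub>b f\<^sub>c\<close> in three distinct letters may be replaced, at the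
  cost of a sign, by the missing fourth letter, provided the two letters form one of the pairs
  \<open>01, 02, 13, 23\<close>. These pairs are the edges of a four-cycle, and the rule is a sliding puzzle on
  it: three tokens and one hole. Moving the hole once around the cycle takes four moves, so the
  sign is \<open>+1\<close>, and permutes the tokens cyclically (\<open>word_rotate\<close>). Thus
  \<open>f\<^sub>2 f\<^sub>1 f\<^sub>0 \<equiv> f\<^sub>0 f\<^sub>2 f\<^sub>1\<close> and \<open>f\<^sub>0 f\<^sub>1 f\<^sub>2 \<equiv> f\<^sub>1 f\<^sub>2 f\<^sub>0\<close>, and the four terms of
  \<open>3^9 [[x\<^sub>2, x\<^sub>1], x\<^sub>0] = 3^6 (f\<^sub>2 f\<^sub>1 f\<^sub>0 - f\<^sub>1 f\<^sub>2 f\<^sub>0 - f\<^sub>0 f\<^sub>2 f\<^sub>1 + f\<^sub>0 f\<^sub>1 f\<^sub>2)\<close> cancel in pairs. Passing from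
  this ring commutator to \<open>\<omega> - 1\<close> costs only terms of \<open>\<varpi>\<^sup>7\<close>.
\<close>

section \<open>Powers of the augmentation ideal\<close>

lemma frag_cmul_diff_right: "frag_cmul c (x - y) = frag_cmul c x - frag_cmul c y"
  by (rule poly_mapping_eqI) (simp add: lookup_minus right_diff_distrib)

context group
begin

abbreviation gr_mult (infixl \<open>\<star>\<close> 70)
  where "x \<star> y \<equiv> x \<otimes>\<^bsub>group_ring G\<^esub> y"

definition aug_power :: "nat \<Rightarrow> ('a \<Rightarrow>\<^sub>0 int) set"
  where "aug_power n = augmentation_ideal G [^]\<^bsub>ideals_set (group_ring G)\<^esub> n"

definition minus_one :: "'a \<Rightarrow> ('a \<Rightarrow>\<^sub>0 int)"
  where "minus_one g = frag_of g - frag_of \<one>"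

lemma group_ring_is_ring: "ring (group_ring G)"
  by (rule ring_group_ring) (rule group_axioms)

lemma gr_add: "x \<oplus>\<^bsub>group_ring G\<^esub> y = x + y" "\<zero>\<^bsub>group_ring G\<^esub> = 0" "\<one>\<^bsub>group_ring G\<^esub> = frag_of \<one>"
  by (simp_all add: group_ring_def)

lemma frag_of_carrier [simp]: "frag_of g \<in> carrier (group_ring G) \<longleftrightarrow> g \<in> carrier G"
  by (simp add: group_ring_def)

lemma minus_one_carrier: "g \<in> carrier G \<Longrightarrow> minus_one g \<in> carrier (group_ring G)"
  by (auto simp: minus_one_def group_ring_def dest: subsetD[OF keys_diff])

lemma gr_mult_linear:
  "(x + x') \<star> y = x \<star> y + x' \<star> y"
  "x \<star> (y + y') = x \<star> y + x \<star> y'"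
  "(x - x') \<star> y = x \<star> y - x' \<star> y"
  "x \<star> (y - y') = x \<star> y - x \<star> y'"
  "frag_cmul c x \<star> y = frag_cmul c (x \<star> y)"
  "x \<star> frag_cmul c y = frag_cmul c (x \<star> y)"
proof -
  show "(x - x') \<star> y = x \<star> y - x' \<star> y" "x \<star> (y - y') = x \<star> y - x \<star> y'"
    by (rule group_ring_mult_diff)+
  show "(x + x') \<star> y = x \<star> y + x' \<star> y" "x \<star> (y + y') = x \<star> y + x \<star> y'"
    using group_ring_mult_diff(1)[of G x "- x'" y] group_ring_mult_diff(1)[of G 0 x' y]
      group_ring_mult_diff(2)[of G x y "- y'"] group_ring_mult_diff(2)[of G x 0 y']
    by (simp_all add: group_ring_mult_diff(3,4))
  show "frag_cmul c x \<star> y = frag_cmul c (x \<star> y)" "x \<star> frag_cmul c y = frag_cmul c (x \<star> y)"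
    by (simp_all add: group_ring_def frag_extend_cmul)
      (simp add: frag_extend_def frag_cmul_sum mult.left_commute)
qed

lemma gr_mult_one:
  assumes "x \<in> carrier (group_ring G)"
  shows "frag_of \<one> \<star> x = x" "x \<star> frag_of \<one> = x"
  using assms monoid.l_one[OF ring.is_monoid[OF group_ring_is_ring]] monoid.r_one[OF ring.is_monoid[OF group_ring_is_ring]]
  by (simp_all flip: gr_add(3))

lemma ideal_aug_power: "ideal (aug_power n) (group_ring G)"
proof (induction n)
  case 0
  show ?case
    using ring.oneideal[OF group_ring_is_ring] by (simp add: aug_power_def nat_pow_def ideals_set_def)
next
  case (Suc n)
  then show ?case
    using ring.ideal_prod_is_ideal[OF group_ring_is_ring Suc ideal_augmentation_ideal[OF group_axioms]]
    by (simp add: aug_power_def nat_pow_def ideals_set_def)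
qed

lemma aug_power_carrier: "x \<in> aug_power n \<Longrightarrow> x \<in> carrier (group_ring G)"
  using ideal.Icarr[OF ideal_aug_power] by blast

lemma aug_power_Suc: "aug_power (Suc n) = ideal_prod (group_ring G) (aug_power n) (augmentation_ideal G)"
  by (simp add: aug_power_def nat_pow_def ideals_set_def)

lemma aug_power_add: "x \<in> aug_power n \<Longrightarrow> y \<in> aug_power n \<Longrightarrow> x + y \<in> aug_power n"
  using additive_subgroup.a_closed[OF ideal.axioms(1)[OF ideal_aug_power]]
  by (simp add: gr_add)

lemma aug_power_diff:
  assumes "x \<in> aug_power n" "y \<in> aug_power n"
  shows "x - y \<in> aug_power n"
proof -
  interpret R: ring "group_ring G" by (rule group_ring_is_ring)
  have "x \<ominus>\<^bsub>group_ring G\<^esub> y \<in> aug_power n"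
    using assms additive_subgroup.a_closed[OF ideal.axioms(1)[OF ideal_aug_power]]
      additive_subgroup.a_inv_closed[OF ideal.axioms(1)[OF ideal_aug_power]] R.minus_eq
    by metis
  then show ?thesis
    using group_ring_minus[OF group_axioms] assms aug_power_carrier by metis
qed

lemma aug_power_zero: "0 \<in> aug_power n"
  using additive_subgroup.zero_closed[OF ideal.axioms(1)[OF ideal_aug_power]]
  by (simp add: gr_add)

lemma aug_power_cmul:
  assumes "x \<in> aug_power n"
  shows "frag_cmul c x \<in> aug_power n"
proof (induction c rule: int_induct[where k = 0])
  case base
  then show ?case by (simp add: aug_power_zero)
next
  case (step1 i)
  then show ?case using assms by (simp add: frag_cmul_distrib aug_power_add)
next
  case (step2 i)
  then show ?case using assms by (simp add: frag_cmul_diff_distrib aug_power_diff)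
qed

lemma aug_power_mult:
  assumes x: "x \<in> aug_power m" and "y \<in> aug_power n"
  shows "x \<star> y \<in> aug_power (m + n)"
  using assms(2)
proof (induction n arbitrary: y)
  case 0
  then show ?case
    using ideal.I_r_closed[OF ideal_aug_power x aug_power_carrier[OF 0]] by simp
next
  case (Suc n)
  interpret R: ring "group_ring G" by (rule group_ring_is_ring)
  have "y \<in> ideal_prod (group_ring G) (aug_power n) (augmentation_ideal G)"
    using Suc.prems by (simp add: aug_power_Suc)
  then show ?case
  proof induction
    case (prod i j)
    have "(x \<star> i) \<star> j \<in> aug_power (Suc (m + n))"
      unfolding aug_power_Suc by (rule ideal_prod.prod[OF Suc.IH[OF prod(1)] prod(2)])
    then show ?case
      using x prod aug_power_carrier by (simp add: R.m_assoc augmentation_ideal_def)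
  next
    case (sum s t)
    then show ?case by (simp add: gr_add gr_mult_linear aug_power_add)
  qed
qed

lemma aug_power_antimono:
  assumes "x \<in> aug_power n" "m \<le> n"
  shows "x \<in> aug_power m"
proof -
  have "aug_power (Suc k) \<subseteq> aug_power k" for k
    unfolding aug_power_Suc
    using ring.ideal_prod_inter[OF group_ring_is_ring ideal_aug_power
        ideal_augmentation_ideal[OF group_axioms]] by blast
  from lift_Suc_antimono_le[of aug_power, OF this assms(2)] assms(1) show ?thesis by blast
qed

lemma minus_one_aug_power_1:
  assumes "g \<in> carrier G"
  shows "minus_one g \<in> aug_power 1"
proof -
  have "augmentation_ideal G = aug_power 1"
  proof -
    have "aug_power 1 = ideal_prod (group_ring G) (carrier (group_ring G)) (augmentation_ideal G)"
      by (simp add: aug_power_def nat_pow_def ideals_set_def)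
    also have "\<dots> = augmentation_ideal G"
    proof
      show "ideal_prod (group_ring G) (carrier (group_ring G)) (augmentation_ideal G) \<subseteq> augmentation_ideal G"
        using ring.ideal_prod_inter[OF group_ring_is_ring ring.oneideal[OF group_ring_is_ring]
            ideal_augmentation_ideal[OF group_axioms]] by blast
      show "augmentation_ideal G \<subseteq> ideal_prod (group_ring G) (carrier (group_ring G)) (augmentation_ideal G)"
      proof
        fix x assume x: "x \<in> augmentation_ideal G"
        have "frag_of \<one> \<star> x \<in> ideal_prod (group_ring G) (carrier (group_ring G)) (augmentation_ideal G)"
          using x by (intro ideal_prod.prod) auto
        then show "x \<in> ideal_prod (group_ring G) (carrier (group_ring G)) (augmentation_ideal G)"
          using x by (simp add: gr_mult_one augmentation_ideal_def)
      qed
    qed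
    finally show ?thesis ..
  qed
  moreover have "augmentation (minus_one g) = 0"
  proof (cases "g = \<one>")
    case True
    then show ?thesis by (simp add: augmentation_def minus_one_def)
  next
    case False
    have "Poly_Mapping.keys (frag_of g - frag_of \<one>) = {g, \<one>}"
      using False by (auto simp: in_keys_iff lookup_minus lookup_frag_of split: if_splits)
    then show ?thesis
      using False by (simp add: augmentation_def minus_one_def lookup_minus lookup_frag_of)
  qed
  ultimately show ?thesis
    using assms minus_one_carrier by (auto simp: augmentation_ideal_def)
qed

lemma dimension_subgroup_iff:
  "g \<in> dimension_subgroup n G \<longleftrightarrow> g \<in> carrier G \<and> minus_one g \<in> aug_power n"
  by (auto simp: dimension_subgroup_def minus_one_def aug_power_def gr_add group_ring_minus[OF group_axioms])

section \<open>Commutators and powers in the group ring\<close>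

lemma minus_one_mult:
  assumes "g \<in> carrier G" "h \<in> carrier G"
  shows "minus_one (g \<otimes> h) = minus_one g + minus_one h + minus_one g \<star> minus_one h"
  using assms by (simp add: minus_one_def gr_mult_linear group_ring_mult_of)

text \<open>
  This is \<open>[g, h] - 1 = g\<^sup>-\<^sup>1h\<^sup>-\<^sup>1(gh - hg)\<close>, together with the fact that \<open>gh - hg\<close> does not change when
  \<open>1\<close> is subtracted from \<open>g\<close> and from \<open>h\<close>.
\<close>

lemma minus_one_commutator:
  assumes g: "g \<in> carrier G" and h: "h \<in> carrier G"
  shows "minus_one (commutator G g h)
    = frag_of (inv g \<otimes> inv h) \<star> (minus_one g \<star> minus_one h - minus_one h \<star> minus_one g)"
proof -
  have "minus_one g \<star> minus_one h - minus_one h \<star> minus_one g = frag_of (g \<otimes> h) - frag_of (h \<otimes> g)"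
    using assms by (simp add: minus_one_def gr_mult_linear group_ring_mult_of)
  moreover have "inv g \<otimes> inv h \<otimes> (h \<otimes> g) = \<one>" "inv g \<otimes> inv h \<otimes> (g \<otimes> h) = commutator G g h"
    using assms by (simp_all add: commutator_def m_assoc inv_solve_left' flip: m_assoc[of "inv h" h g])
  ultimately show ?thesis
    by (simp only: minus_one_def gr_mult_linear(4) group_ring_mult_of)
qed

text \<open>
  The unit in front of the ring commutator is \<open>1\<close> modulo \<open>\<varpi>\<close>, so it changes only deeper terms. The
  multiple \<open>c\<close> is carried along because \<open>c\<close> times the ring commutator can lie much deeper than the
  ring commutator itself.
\<close>

lemma minus_one_commutator_approx:
  assumes g: "g \<in> carrier G" and h: "h \<in> carrier G"
    and q: "frag_cmul c (minus_one g \<star> minus_one h - minus_one h \<star> minus_one g) \<in> aug_power n"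
  shows "frag_cmul c (minus_one (commutator G g h)) \<in> aug_power n"
    and "frag_cmul c (minus_one (commutator G g h)
      - (minus_one g \<star> minus_one h - minus_one h \<star> minus_one g)) \<in> aug_power (Suc n)"
proof -
  define z where "z = minus_one g \<star> minus_one h - minus_one h \<star> minus_one g"
  have "z \<in> aug_power 2"
    unfolding z_def using aug_power_mult[of _ 1 _ 1] minus_one_aug_power_1 g h
    by (intro aug_power_diff) (simp_all add: numeral_2_eq_2)
  then have zc: "z \<in> carrier (group_ring G)"
    by (rule aug_power_carrier)
  have "minus_one (commutator G g h) - z = minus_one (inv g \<otimes> inv h) \<star> z"
    using zc by (simp only: minus_one_commutator[OF g h] z_def[symmetric])
      (simp add: minus_one_def gr_mult_linear gr_mult_one)
  then have "frag_cmul c (minus_one (commutator G g h) - z) = minus_one (inv g \<otimes> inv h) \<star> frag_cmul c z"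
    by (simp add: gr_mult_linear)
  also have "\<dots> \<in> aug_power (1 + n)"
    using q g h by (intro aug_power_mult minus_one_aug_power_1) (simp_all add: z_def)
  finally show 1: "frag_cmul c (minus_one (commutator G g h)
      - (minus_one g \<star> minus_one h - minus_one h \<star> minus_one g)) \<in> aug_power (Suc n)"
    by (simp add: z_def)
  show "frag_cmul c (minus_one (commutator G g h)) \<in> aug_power n"
    using aug_power_add[OF aug_power_antimono[OF 1, of n] q] by (simp flip: frag_cmul_distrib2)
qed

lemma minus_one_commutator_aug_power:
  assumes "g \<in> carrier G" "h \<in> carrier G"
    and "minus_one g \<in> aug_power m" "minus_one h \<in> aug_power n"
  shows "minus_one (commutator G g h) \<in> aug_power (m + n)"
  using minus_one_commutator_approx(1)[of g h 1 "m + n"] aug_power_mult[OF assms(3,4)]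
    aug_power_mult[OF assms(4,3)] assms
  by (simp add: aug_power_diff add.commute)

lemma minus_one_nat_pow_approx:
  assumes g: "g \<in> carrier G" and "minus_one g \<in> aug_power r"
  shows "minus_one (g [^] (n::nat)) - frag_cmul (int n) (minus_one g) \<in> aug_power (2 * r)"
proof (induction n)
  case 0
  then show ?case by (simp add: minus_one_def aug_power_zero)
next
  case (Suc n)
  let ?x = "minus_one g" and ?z = "minus_one (g [^] n)"
  have "?z \<in> aug_power r"
    using aug_power_add[OF aug_power_antimono[OF Suc, of r] aug_power_cmul[OF assms(2), of "int n"]]
    by simp
  then have "?z \<star> ?x \<in> aug_power (2 * r)"
    using aug_power_mult assms(2) by (simp add: mult_2)
  moreover have "minus_one (g [^] Suc n) - frag_cmul (int (Suc n)) ?x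
      = (?z - frag_cmul (int n) ?x) + ?z \<star> ?x"
    using g by (simp add: minus_one_mult frag_cmul_distrib)
  ultimately show ?case
    using aug_power_add[OF Suc] by simp
qed

text \<open>
  The expansion of \<open>(1 + x)\<^sup>n\<close> is cut off at degree five because its terms get multiplied by
  two further elements of \<open>\<varpi>\<close>, which moves the remainder into \<open>\<varpi>\<^sup>7\<close>.
\<close>

lemma minus_one_nat_pow_binomial:
  fixes n :: nat
  assumes g: "g \<in> carrier G"
  defines "x \<equiv> minus_one g"
  shows "minus_one (g [^] n) - (frag_cmul (int n) x + frag_cmul (int (n choose 2)) (x \<star> x)
      + frag_cmul (int (n choose 3)) (x \<star> x \<star> x) + frag_cmul (int (n choose 4)) (x \<star> x \<star> x \<star> x))
    \<in> aug_power 5"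
proof (induction n)
  case 0
  then show ?case by (simp add: minus_one_def aug_power_zero binomial_eq_0)
next
  case (Suc n)
  define p where "p = (\<lambda>n. frag_cmul (int n) x + frag_cmul (int (n choose 2)) (x \<star> x)
      + frag_cmul (int (n choose 3)) (x \<star> x \<star> x) + frag_cmul (int (n choose 4)) (x \<star> x \<star> x \<star> x))"
  have x: "x \<in> aug_power 1" "x \<in> carrier (group_ring G)"
    using minus_one_aug_power_1[OF g] minus_one_carrier[OF g] by (simp_all add: x_def)
  have x5: "x \<star> x \<star> x \<star> x \<star> x \<in> aug_power 5"
  proof -
    have "x \<star> x \<in> aug_power (1+1)" by (intro aug_power_mult x)
    then have "x \<star> x \<star> x \<in> aug_power (1+1+1)" by (intro aug_power_mult x)
    then have "x \<star> x \<star> x \<star> x \<in> aug_power (1+1+1+1)" by (intro aug_power_mult x)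
    then have "x \<star> x \<star> x \<star> x \<star> x \<in> aug_power (1+1+1+1+1)" by (intro aug_power_mult x)
    then show ?thesis by (simp add: eval_nat_numeral)
  qed
  have IH: "minus_one (g [^] n) - p n \<in> aug_power 5"
    using Suc by (simp add: p_def)
  have ch: "int (Suc n choose 2) = int (n choose 2) + int n"
    "int (Suc n choose 3) = int (n choose 3) + int (n choose 2)"
    "int (Suc n choose 4) = int (n choose 4) + int (n choose 3)"
    by (simp_all add: eval_nat_numeral)
  have p: "p (Suc n) = p n + x + p n \<star> x - frag_cmul (int (n choose 4)) (x \<star> x \<star> x \<star> x \<star> x)"
    unfolding p_def ch by (simp add: gr_mult_linear frag_cmul_distrib)
  have "minus_one (g [^] Suc n) = minus_one (g [^] n) + x + minus_one (g [^] n) \<star> x"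
    using g by (simp add: minus_one_mult x_def)
  then have "minus_one (g [^] Suc n) - p (Suc n) = (minus_one (g [^] n) - p n)
      + (minus_one (g [^] n) - p n) \<star> x + frag_cmul (int (n choose 4)) (x \<star> x \<star> x \<star> x \<star> x)"
    unfolding p gr_mult_linear(3) by simp
  also have "\<dots> \<in> aug_power 5"
    using IH x5 aug_power_antimono[OF aug_power_mult[OF IH x(1)], of 5]
    by (intro aug_power_add aug_power_cmul) simp_all
  finally show ?case by (simp add: p_def)
qed

end


section \<open>One generator in a slot\<close>

text \<open>
  Both divisibilities come from absorption, \<open>r (n choose r) = n (n - 1 choose r - 1)\<close>.
\<close>

lemma power_dvd_choose_coprime:
  fixes q r n :: nat
  assumes "coprime q r" "0 < r"
  shows "q ^ n dvd (q ^ n choose r)"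
proof -
  have "q ^ n dvd r * (q ^ n choose r)"
    using times_binomial_minus1_eq[OF assms(2), of "q ^ n"] by simp
  then show ?thesis using assms by (simp add: coprime_dvd_mult_right_iff)
qed

lemma power_dvd_choose_self:
  fixes p n :: nat
  assumes "0 < p"
  shows "p ^ (n - 1) dvd (p ^ n choose p)"
proof (cases n)
  case (Suc m)
  have "p * (p ^ n choose p) = p * (p ^ m * (p ^ n - 1 choose (p - 1)))"
    using times_binomial_minus1_eq[OF assms, of "p ^ n"] by (simp add: Suc mult.assoc)
  then show ?thesis using assms by (simp add: Suc)
qed simp

text \<open>
  A slot is the operation of filling the gap in a word of length three whose other letters are \<open>x\<^sub>k\<close>
  and \<open>x\<^sub>l\<close>, that is, one of \<open>z x\<^sub>k x\<^sub>l\<close>, \<open>x\<^sub>k z x\<^sub>l\<close> and \<open>x\<^sub>k x\<^sub>l z\<close>. Its axioms record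
  what the two letters contribute to the depth: one each, while the multiple \<open>3^(2k)\<close> raises \<open>x\<^sub>k\<close>
  into \<open>\<varpi>\<^sup>2\<close> and the multiple \<open>3^(2k+2l)\<close> raises both letters.
  This treats the three positions of the gap at once.
\<close>

locale slot = group G for G (structure) +
  fixes \<phi> :: "('a \<Rightarrow>\<^sub>0 int) \<Rightarrow> ('a \<Rightarrow>\<^sub>0 int)" and k l :: nat
  assumes add: "\<phi> (x + y) = \<phi> x + \<phi> y"
    and cmul: "\<phi> (frag_cmul c x) = frag_cmul c (\<phi> x)"
    and raise2: "x \<in> aug_power r \<Longrightarrow> \<phi> x \<in> aug_power (r + 2)"
    and raise3: "x \<in> aug_power r \<Longrightarrow> frag_cmul (3 ^ (2 * k)) (\<phi> x) \<in> aug_power (r + 3)"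
    and raise4: "x \<in> aug_power r \<Longrightarrow> frag_cmul (3 ^ (2 * k + 2 * l)) (\<phi> x) \<in> aug_power (r + 4)"
begin

lemma diff: "\<phi> (x - y) = \<phi> x - \<phi> y"
  using add[of "x - y" y] by simp

lemma raise3_dvd:
  assumes "x \<in> aug_power r" "3 ^ (2 * k) dvd c" "n = r + 3"
  shows "frag_cmul c (\<phi> x) \<in> aug_power n"
proof -
  obtain d where c: "c = d * 3 ^ (2 * k)"
    using assms(2) by (auto simp: mult.commute elim: dvdE)
  show ?thesis
    using aug_power_cmul[OF raise3[OF assms(1)], of d] by (simp add: c assms(3))
qed

lemma raise4_dvd:
  assumes "x \<in> aug_power r" "3 ^ (2 * k + 2 * l) dvd c" "n = r + 4"
  shows "frag_cmul c (\<phi> x) \<in> aug_power n"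
proof -
  obtain d where c: "c = d * 3 ^ (2 * k + 2 * l)"
    using assms(2) by (auto simp: mult.commute elim: dvdE)
  show ?thesis
    using aug_power_cmul[OF raise4[OF assms(1)], of d] by (simp add: c assms(3))
qed

text \<open>
  In a slot the terms of degree \<open>2\<close>, \<open>3\<close> and \<open>4\<close> in \<open>x = g - 1\<close> of \<open>g ^ 3^(12-i)\<close> all vanish modulo \<open>\<varpi>\<^sup>7\<close>.
  In degree \<open>2\<close> three of the four letters \<open>x, x, x\<^sub>k, x\<^sub>l\<close> have to be raised, at the price
  \<open>3^(2j+2k+2l) = 3^(12-2i)\<close>, which the binomial coefficient, a multiple of
  \<open>3^(12-i)\<close>, pays. In degree \<open>3\<close> raising \<open>x\<^sub>k\<close> and \<open>x\<^sub>l\<close> is enough, with price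
  \<open>3^(12-2i-2j)\<close>; the binomial coefficient supplies \<open>3^(11-i)\<close>, which suffices as \<open>i\<close> and \<open>j\<close> are not
  both \<open>0\<close>. In degree \<open>4\<close> raising \<open>x\<^sub>k\<close> is enough.

  The second claim is for the cross term \<open>(g ^ M - 1)(h ^ N - 1)\<close> of a product \<open>g ^ M h ^ N\<close>. There
  \<open>y \<in> \<varpi>\<^sup>2\<close> already contributes two: raising \<open>x\<close> and \<open>x\<^sub>k\<close> is enough for the linear term, and raising
  \<open>x\<^sub>k\<close> for the quadratic one.
\<close>

lemma
  assumes ijkl: "i + j + k + l = 6" "i \<noteq> j"
    and g: "g \<in> carrier G" "frag_cmul (3 ^ (2 * j)) (minus_one g) \<in> aug_power 2"
  shows slot_power: "\<phi> (minus_one (g [^] ((3::nat) ^ (12 - i)))) - frag_cmul (3 ^ (12 - i)) (\<phi> (minus_one g))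
      \<in> aug_power 7" (is ?power)
    and slot_power_mult: "y \<in> aug_power 2 \<Longrightarrow> \<phi> (minus_one (g [^] ((3::nat) ^ (12 - i))) \<star> y) \<in> aug_power 7"
proof -
  define x where "x = minus_one g"
  define M :: nat where "M = 3 ^ (12 - i)"
  define c where "c = (\<lambda>r. int (M choose r))"
  have "3 ^ (12 - i) dvd M choose 2" "3 ^ (11 - i) dvd M choose 3" "3 ^ (12 - i) dvd M choose 4"
    using power_dvd_choose_coprime[of 3 2 "12 - i"] power_dvd_choose_self[of 3 "12 - i"]
      power_dvd_choose_coprime[of 3 4 "12 - i"] by (simp_all add: M_def coprime_iff_gcd_eq_1 gcd_nat.simps)
  then have "int (3 ^ (12 - i)) dvd c 2" "int (3 ^ (11 - i)) dvd c 3" "int (3 ^ (12 - i)) dvd c 4"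
    by (simp_all only: c_def of_nat_dvd_iff)
  then have c2: "3 ^ (12 - i) dvd c 2" and c3: "3 ^ (11 - i) dvd c 3" and c4: "3 ^ (12 - i) dvd c 4"
    by simp_all
  have x: "x \<in> aug_power 1" "frag_cmul (3 ^ (2 * j)) x \<in> aug_power 2"
    using g minus_one_aug_power_1[OF g(1)] by (simp_all add: x_def)
  have x2: "x \<star> x \<in> aug_power 2"
    using aug_power_mult[OF x(1) x(1)] by (simp add: numeral_2_eq_2)
  have x3: "x \<star> x \<star> x \<in> aug_power 3"
    using aug_power_mult[OF x2 x(1)] by simp
  have x4: "x \<star> x \<star> x \<star> x \<in> aug_power 4"
    using aug_power_mult[OF x3 x(1)] by simp
  define R where "R = minus_one (g [^] M) - (frag_cmul (int M) x + frag_cmul (c 2) (x \<star> x)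
      + frag_cmul (c 3) (x \<star> x \<star> x) + frag_cmul (c 4) (x \<star> x \<star> x \<star> x))"
  have R: "R \<in> aug_power 5"
    using minus_one_nat_pow_binomial[OF g(1), of M] by (simp add: R_def x_def c_def)
  have decomp: "minus_one (g [^] M) = frag_cmul (int M) x + frag_cmul (c 2) (x \<star> x)
      + frag_cmul (c 3) (x \<star> x \<star> x) + frag_cmul (c 4) (x \<star> x \<star> x \<star> x) + R"
    by (simp add: R_def)

  have "frag_cmul (c 2) (\<phi> (x \<star> x)) \<in> aug_power 7"
  proof -
    have "(3::int) ^ (2 * j) * 3 ^ (2 * k + 2 * l) dvd 3 ^ (12 - i)"
      unfolding power_add[symmetric] using ijkl by (intro le_imp_power_dvd) simp
    from dvd_trans[OF this c2] obtain d where "c 2 = 3 ^ (2 * j) * 3 ^ (2 * k + 2 * l) * d"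
      by (rule dvdE)
    then have d: "c 2 = d * 3 ^ (2 * k + 2 * l) * 3 ^ (2 * j)"
      by (simp only: mult_ac)
    have "frag_cmul (d * 3 ^ (2 * k + 2 * l)) (\<phi> (frag_cmul (3 ^ (2 * j)) x \<star> x)) \<in> aug_power 7"
      by (rule raise4_dvd[OF aug_power_mult[OF x(2,1)]]) simp_all
    then show ?thesis by (simp add: d gr_mult_linear cmul)
  qed
  moreover have "frag_cmul (c 3) (\<phi> (x \<star> x \<star> x)) \<in> aug_power 7"
  proof (rule raise4_dvd[OF x3])
    have "(3::int) ^ (2 * k + 2 * l) dvd 3 ^ (11 - i)"
      using ijkl by (intro le_imp_power_dvd) linarith
    then show "3 ^ (2 * k + 2 * l) dvd c 3" using c3 by (rule dvd_trans)
  qed simp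
  moreover have "frag_cmul (c 4) (\<phi> (x \<star> x \<star> x \<star> x)) \<in> aug_power 7"
  proof (rule raise3_dvd[OF x4])
    have "(3::int) ^ (2 * k) dvd 3 ^ (12 - i)"
      using ijkl by (intro le_imp_power_dvd) linarith
    then show "3 ^ (2 * k) dvd c 4" using c4 by (rule dvd_trans)
  qed simp
  moreover have "\<phi> R \<in> aug_power 7"
    using raise2[OF R] by simp
  ultimately have "frag_cmul (c 2) (\<phi> (x \<star> x)) + frag_cmul (c 3) (\<phi> (x \<star> x \<star> x))
      + frag_cmul (c 4) (\<phi> (x \<star> x \<star> x \<star> x)) + \<phi> R \<in> aug_power 7"
    by (intro aug_power_add)
  then have "\<phi> (minus_one (g [^] M)) - frag_cmul (int M) (\<phi> x) \<in> aug_power 7"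
    unfolding decomp by (simp add: add cmul add.assoc)
  then show ?power
    by (simp add: M_def x_def)

  show "\<phi> (minus_one (g [^] ((3::nat) ^ (12 - i))) \<star> y) \<in> aug_power 7" if y: "y \<in> aug_power 2"
  proof -
    define S where "S = frag_cmul (c 3) (x \<star> x \<star> x) + frag_cmul (c 4) (x \<star> x \<star> x \<star> x) + R"
    have "S \<in> aug_power 3"
      unfolding S_def using aug_power_antimono[OF R, of 3] aug_power_antimono[OF x4, of 3] x3
      by (intro aug_power_add aug_power_cmul) simp_all
    then have "\<phi> (S \<star> y) \<in> aug_power 7"
      using raise2[OF aug_power_mult[OF _ y]] by fastforce
    moreover have "frag_cmul (c 2) (\<phi> (x \<star> x \<star> y)) \<in> aug_power 7"
    proof (rule raise3_dvd[OF aug_power_mult[OF x2 y]])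
      have "(3::int) ^ (2 * k) dvd 3 ^ (12 - i)"
        using ijkl by (intro le_imp_power_dvd) linarith
      then show "3 ^ (2 * k) dvd c 2" using c2 by (rule dvd_trans)
    qed simp
    moreover have "frag_cmul (int M) (\<phi> (x \<star> y)) \<in> aug_power 7"
    proof -
      have "int M = 3 ^ (12 - i - 2 * k - 2 * j) * 3 ^ (2 * k) * 3 ^ (2 * j)"
        using ijkl by (simp add: M_def flip: power_add)
      moreover have "frag_cmul (3 ^ (12 - i - 2 * k - 2 * j) * 3 ^ (2 * k))
          (\<phi> (frag_cmul (3 ^ (2 * j)) x \<star> y)) \<in> aug_power 7"
        by (rule raise3_dvd[OF aug_power_mult[OF x(2) y]]) simp_all
      ultimately show ?thesis by (simp add: gr_mult_linear cmul)
    qed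
    ultimately have "frag_cmul (int M) (\<phi> (x \<star> y)) + frag_cmul (c 2) (\<phi> (x \<star> x \<star> y)) + \<phi> (S \<star> y)
        \<in> aug_power 7"
      by (intro aug_power_add)
    moreover have "minus_one (g [^] M) = frag_cmul (int M) x + frag_cmul (c 2) (x \<star> x) + S"
      by (simp add: decomp S_def)
    ultimately show ?thesis
      by (simp add: gr_mult_linear add cmul flip: M_def)
  qed
qed

text \<open>
  In a slot, the nonlinear terms on the left-hand side of the relation vanish modulo \<open>\<varpi>\<^sup>7\<close>, and so
  does the whole right-hand side: its exponent \<open>12 - 2i - 2j = 2k + 2l\<close> raises both letters of the
  slot, which takes \<open>y - 1 \<in> \<varpi>\<^sup>3\<close> to \<open>\<varpi>\<^sup>7\<close>. What remains is the linear part of the left-hand side.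
\<close>

lemma slot_relation:
  assumes ijkl: "i + j + k + l = 6" "i \<noteq> j"
    and g: "g \<in> carrier G" "frag_cmul (3 ^ (2 * i)) (minus_one g) \<in> aug_power 2"
    and h: "h \<in> carrier G" "frag_cmul (3 ^ (2 * j)) (minus_one h) \<in> aug_power 2"
    and y: "y \<in> carrier G" "minus_one y \<in> aug_power 3"
    and rel: "h [^] ((3::nat) ^ (12 - i)) \<otimes> g [^] ((3::nat) ^ (12 - j)) = y [^] ((3::nat) ^ (12 - 2 * i - 2 * j))"
  shows "frag_cmul (3 ^ (12 - j)) (\<phi> (minus_one g)) + frag_cmul (3 ^ (12 - i)) (\<phi> (minus_one h))
    \<in> aug_power 7"
proof -
  define M N K :: nat where MNK: "M = 3 ^ (12 - i)" "N = 3 ^ (12 - j)" "K = 3 ^ (2 * k + 2 * l)"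
  define X Y where XY: "X = minus_one (h [^] M)" "Y = minus_one (g [^] N)"
  have "12 - 2 * i - 2 * j = 2 * k + 2 * l" using ijkl by simp
  then have "minus_one (y [^] K) = X + Y + X \<star> Y"
    using rel g h by (simp add: MNK XY flip: minus_one_mult)
  then have \<phi>: "\<phi> (minus_one (y [^] K)) = \<phi> X + \<phi> Y + \<phi> (X \<star> Y)"
    by (simp add: add)
  have "\<phi> (minus_one (y [^] K)) \<in> aug_power 7"
  proof -
    have "\<phi> (minus_one (y [^] K) - frag_cmul (int K) (minus_one y)) \<in> aug_power 8"
      using raise2[OF minus_one_nat_pow_approx[OF y, of K]] by simp
    then have "\<phi> (minus_one (y [^] K)) - frag_cmul (int K) (\<phi> (minus_one y)) \<in> aug_power 7"
      using aug_power_antimono[of _ 8 7] by (simp add: diff cmul)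
    moreover have "frag_cmul (int K) (\<phi> (minus_one y)) \<in> aug_power 7"
      by (rule raise4_dvd[OF y(2)]) (simp_all add: MNK)
    ultimately show ?thesis using aug_power_add by fastforce
  qed
  moreover have "\<phi> (X \<star> Y) \<in> aug_power 7"
  proof -
    have "int N = 3 ^ (12 - j - 2 * i) * 3 ^ (2 * i)"
      using ijkl by (simp add: MNK flip: power_add)
    then have "frag_cmul (int N) (minus_one g) \<in> aug_power 2"
      using aug_power_cmul[OF g(2)] by (simp flip: frag_cmul_cmul)
    moreover have "Y - frag_cmul (int N) (minus_one g) \<in> aug_power 2"
      using minus_one_nat_pow_approx[OF g(1) minus_one_aug_power_1[OF g(1)]] by (simp add: XY)
    ultimately have "Y \<in> aug_power 2" using aug_power_add by fastforce
    then show ?thesis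
      unfolding XY MNK by (rule slot_power_mult[OF ijkl h])
  qed
  moreover have "\<phi> X - frag_cmul (3 ^ (12 - i)) (\<phi> (minus_one h)) \<in> aug_power 7"
    unfolding XY MNK by (rule slot_power[OF ijkl h])
  moreover have "\<phi> Y - frag_cmul (3 ^ (12 - j)) (\<phi> (minus_one g)) \<in> aug_power 7"
    unfolding XY MNK using ijkl g by (intro slot_power) simp_all
  ultimately have "\<phi> (minus_one (y [^] K)) - \<phi> (X \<star> Y)
      - (\<phi> X - frag_cmul (3 ^ (12 - i)) (\<phi> (minus_one h)))
      - (\<phi> Y - frag_cmul (3 ^ (12 - j)) (\<phi> (minus_one g))) \<in> aug_power 7"
    using aug_power_diff by presburger
  then show ?thesis by (simp add: \<phi> algebra_simps)
qed

end

section \<open>Sliding around the four-cycle\<close>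

text \<open>
  The pairs in the last assumption are the edges of the four-cycle \<open>0, 1, 3, 2\<close>.
\<close>

locale four_cycle_relations = group G for G (structure) +
  fixes e :: "nat \<Rightarrow> 'a"
  assumes e_closed: "i \<le> 3 \<Longrightarrow> e i \<in> carrier G"
    and e_power: "i \<le> 3 \<Longrightarrow> frag_cmul (3 ^ (2 * i)) (minus_one (e i)) \<in> aug_power 2"
    and edge: "(i, j) \<in> {(0, 1), (0, 2), (1, 3), (2, 3)} \<Longrightarrow>
      \<exists>y\<in>carrier G. minus_one y \<in> aug_power 3 \<and>
        e j [^] ((3::nat) ^ (12 - i)) \<otimes> e i [^] ((3::nat) ^ (12 - j)) = y [^] ((3::nat) ^ (12 - 2 * i - 2 * j))"
begin

abbreviation x :: "nat \<Rightarrow> ('a \<Rightarrow>\<^sub>0 int)"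
  where "x i \<equiv> minus_one (e i)"

lemma x_aug_power: "i \<le> 3 \<Longrightarrow> x i \<in> aug_power 1"
  by (simp only: e_closed minus_one_aug_power_1)

lemma slots:
  assumes kl: "k \<le> 3" "l \<le> 3"
  shows "slot G (\<lambda>z. z \<star> x k \<star> x l) k l"
    and "slot G (\<lambda>z. x k \<star> z \<star> x l) k l"
    and "slot G (\<lambda>z. x k \<star> x l \<star> z) k l"
proof -
  have prod: "u \<star> v \<star> w \<in> aug_power n"
    if "u \<in> aug_power a" "v \<in> aug_power b" "w \<in> aug_power c" "n = a + b + c" for u v w a b c n
    using aug_power_mult[OF aug_power_mult[OF that(1,2)] that(3)] that(4) by simp
  let ?xk = "frag_cmul (3 ^ (2 * k)) (x k)" and ?xl = "frag_cmul (3 ^ (2 * l)) (x l)"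
  note m = x_aug_power[OF kl(1)] x_aug_power[OF kl(2)] e_power[OF kl(1)] e_power[OF kl(2)]
  show "slot G (\<lambda>z. z \<star> x k \<star> x l) k l"
  proof unfold_locales
    fix z r assume z: "z \<in> aug_power r"
    show "z \<star> x k \<star> x l \<in> aug_power (r + 2)"
      by (rule prod[OF z m(1,2)]) simp
    have "z \<star> ?xk \<star> x l \<in> aug_power (r + 3)"
      by (rule prod[OF z m(3,2)]) simp
    then show "frag_cmul (3 ^ (2 * k)) (z \<star> x k \<star> x l) \<in> aug_power (r + 3)"
      by (simp add: gr_mult_linear)
    have "z \<star> ?xk \<star> ?xl \<in> aug_power (r + 4)"
      by (rule prod[OF z m(3,4)]) simp
    then show "frag_cmul (3 ^ (2 * k + 2 * l)) (z \<star> x k \<star> x l) \<in> aug_power (r + 4)"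
      by (simp add: gr_mult_linear power_add mult.commute)
  qed (simp_all add: gr_mult_linear)
  show "slot G (\<lambda>z. x k \<star> z \<star> x l) k l"
  proof unfold_locales
    fix z r assume z: "z \<in> aug_power r"
    show "x k \<star> z \<star> x l \<in> aug_power (r + 2)"
      by (rule prod[OF m(1) z m(2)]) simp
    have "?xk \<star> z \<star> x l \<in> aug_power (r + 3)"
      by (rule prod[OF m(3) z m(2)]) simp
    then show "frag_cmul (3 ^ (2 * k)) (x k \<star> z \<star> x l) \<in> aug_power (r + 3)"
      by (simp add: gr_mult_linear)
    have "?xk \<star> z \<star> ?xl \<in> aug_power (r + 4)"
      by (rule prod[OF m(3) z m(4)]) simp
    then show "frag_cmul (3 ^ (2 * k + 2 * l)) (x k \<star> z \<star> x l) \<in> aug_power (r + 4)"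
      by (simp add: gr_mult_linear power_add mult.commute)
  qed (simp_all add: gr_mult_linear)
  show "slot G (\<lambda>z. x k \<star> x l \<star> z) k l"
  proof unfold_locales
    fix z r assume z: "z \<in> aug_power r"
    show "x k \<star> x l \<star> z \<in> aug_power (r + 2)"
      by (rule prod[OF m(1,2) z]) simp
    have "?xk \<star> x l \<star> z \<in> aug_power (r + 3)"
      by (rule prod[OF m(3,2) z]) simp
    then show "frag_cmul (3 ^ (2 * k)) (x k \<star> x l \<star> z) \<in> aug_power (r + 3)"
      by (simp add: gr_mult_linear)
    have "?xk \<star> ?xl \<star> z \<in> aug_power (r + 4)"
      by (rule prod[OF m(3,4) z]) simp
    then show "frag_cmul (3 ^ (2 * k + 2 * l)) (x k \<star> x l \<star> z) \<in> aug_power (r + 4)"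
      by (simp add: gr_mult_linear power_add mult.commute)
  qed (simp_all add: gr_mult_linear)
qed

text \<open>
  This is \<open>3^6 f\<^sub>a f\<^sub>b f\<^sub>c\<close> for \<open>f\<^sub>i = 3^i x\<^sub>i\<close>, the scaling in which the relations have coefficients \<open>1\<close>.
\<close>

definition word :: "nat \<Rightarrow> nat \<Rightarrow> nat \<Rightarrow> ('a \<Rightarrow>\<^sub>0 int)"
  where "word a b c = frag_cmul (3 ^ (6 + a + b + c)) (x a \<star> x b \<star> x c)"

text \<open>
  One move of the sliding puzzle: the letters \<open>i\<close> and \<open>j\<close> are joined by an edge, and the sum condition
  holds when \<open>k\<close> and \<open>l\<close> are the other two indices.
  The scaling of words turns the coefficients \<open>3^(12-j)\<close> and \<open>3^(12-i)\<close> of the relation into \<open>1\<close>.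
\<close>

lemma word_slide:
  assumes ij: "(i, j) \<in> {(0, 1), (0, 2), (1, 3), (2, 3)}" and sum: "i + j + k + l = 6"
    and kl: "k \<le> 3" "l \<le> 3"
  shows "word i k l + word j k l \<in> aug_power 7"
    and "word k i l + word k j l \<in> aug_power 7"
    and "word k l i + word k l j \<in> aug_power 7"
proof -
  have ij': "i \<noteq> j" "i \<le> 3" "j \<le> 3" using ij by auto
  obtain y where y: "y \<in> carrier G" "minus_one y \<in> aug_power 3"
    "e j [^] ((3::nat) ^ (12 - i)) \<otimes> e i [^] ((3::nat) ^ (12 - j)) = y [^] ((3::nat) ^ (12 - 2 * i - 2 * j))"
    using edge[OF ij] by blast
  have rel: "frag_cmul (3 ^ (12 - j)) (\<phi> (x i)) + frag_cmul (3 ^ (12 - i)) (\<phi> (x j)) \<in> aug_power 7"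
    if "slot G \<phi> k l" for \<phi>
    using slot.slot_relation[OF that sum] ij' e_closed e_power y by blast
  have "12 - j = 6 + i + k + l" "12 - i = 6 + j + k + l"
    "6 + i + k + l = 6 + k + i + l" "6 + j + k + l = 6 + k + j + l"
    "6 + i + k + l = 6 + k + l + i" "6 + j + k + l = 6 + k + l + j"
    using sum by simp_all
  then show "word i k l + word j k l \<in> aug_power 7"
    "word k i l + word k j l \<in> aug_power 7"
    "word k l i + word k l j \<in> aug_power 7"
    using slots[OF kl, THEN rel] unfolding word_def by metis+
qed

text \<open>
  Four moves take the hole once around the cycle, from \<open>3\<close> through \<open>1\<close>, \<open>0\<close> and \<open>2\<close> back to \<open>3\<close>: the
  letters change by \<open>1 \<rightarrow> 3\<close>, \<open>0 \<rightarrow> 1\<close>, \<open>2 \<rightarrow> 0\<close>, \<open>3 \<rightarrow> 2\<close>. The alternating sum of the four moves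
  telescopes.
\<close>

lemma word_rotate:
  shows "word 2 1 0 - word 0 2 1 \<in> aug_power 7"
    and "word 0 1 2 - word 1 2 0 \<in> aug_power 7"
proof -
  have 1: "word 2 1 0 + word 2 3 0 \<in> aug_power 7"
    by (rule word_slide(2)) simp_all
  have 2: "word 2 3 0 + word 2 3 1 \<in> aug_power 7"
    by (rule word_slide(3)) simp_all
  have 3: "word 0 3 1 + word 2 3 1 \<in> aug_power 7"
    by (rule word_slide(1)) simp_all
  have 4: "word 0 2 1 + word 0 3 1 \<in> aug_power 7"
    by (rule word_slide(2)) simp_all
  have "(word 2 1 0 + word 2 3 0) - (word 2 3 0 + word 2 3 1) + ((word 0 3 1 + word 2 3 1)
      - (word 0 2 1 + word 0 3 1)) \<in> aug_power 7"
    by (rule aug_power_add[OF aug_power_diff[OF 1 2] aug_power_diff[OF 3 4]])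
  then show "word 2 1 0 - word 0 2 1 \<in> aug_power 7" by (simp add: algebra_simps)
  have 1: "word 0 1 2 + word 0 3 2 \<in> aug_power 7"
    by (rule word_slide(2)) simp_all
  have 2: "word 0 3 2 + word 1 3 2 \<in> aug_power 7"
    by (rule word_slide(1)) simp_all
  have 3: "word 1 3 0 + word 1 3 2 \<in> aug_power 7"
    by (rule word_slide(3)) simp_all
  have 4: "word 1 2 0 + word 1 3 0 \<in> aug_power 7"
    by (rule word_slide(2)) simp_all
  have "(word 0 1 2 + word 0 3 2) - (word 0 3 2 + word 1 3 2) + ((word 1 3 0 + word 1 3 2)
      - (word 1 2 0 + word 1 3 0)) \<in> aug_power 7"
    by (rule aug_power_add[OF aug_power_diff[OF 1 2] aug_power_diff[OF 3 4]])
  then show "word 0 1 2 - word 1 2 0 \<in> aug_power 7" by (simp add: algebra_simps)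
qed

text \<open>
  The terms by which the iterated group commutator differs from the ring commutator contain
  \<open>x\<^sub>0\<close>, \<open>x\<^sub>1\<close>, \<open>x\<^sub>2\<close> and one more factor from \<open>\<varpi>\<close>, and \<open>3^6\<close> already puts \<open>x\<^sub>0 x\<^sub>1 x\<^sub>2\<close>, in any order,
  into \<open>\<varpi>\<^sup>6\<close>; so even \<open>3^6\<close> times such a term lies in \<open>\<varpi>\<^sup>7\<close>. The full \<open>3^9 = 3^(6+0+1+2)\<close> enters
  with the words.
\<close>

theorem triple_commutator_in_dimension_subgroup:
  "commutator G (commutator G (e 2) (e 1)) (e 0) [^] ((3::nat) ^ 9) \<in> dimension_subgroup 7 G"
proof -
  interpret R: ring "group_ring G" by (rule group_ring_is_ring)
  define d where "d = commutator G (e 2) (e 1)"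
  define w where "w = commutator G d (e 0)"
  define q where "q = x 2 \<star> x 1 - x 1 \<star> x 2"
  define t where "t = minus_one d \<star> x 0 - x 0 \<star> minus_one d"
  have ec: "e 0 \<in> carrier G" "e 1 \<in> carrier G" "e 2 \<in> carrier G"
    using e_closed by simp_all
  then have dc: "d \<in> carrier G" and wc: "w \<in> carrier G"
    by (simp_all add: d_def w_def commutator_closed[OF group_axioms])
  \<comment> \<open>At index \<open>0\<close> the multiple \<open>3^(2i)\<close> is \<open>1\<close>.\<close>
  have x0: "x 0 \<in> aug_power 2" using e_power[of 0] by simp

  have "frag_cmul (3 ^ 4) (x 2) \<star> frag_cmul (3 ^ 2) (x 1)
      - frag_cmul (3 ^ 2) (x 1) \<star> frag_cmul (3 ^ 4) (x 2) \<in> aug_power (2 + 2)"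
    using e_power[of 1] e_power[of 2] by (intro aug_power_diff aug_power_mult) simp_all
  then have q: "frag_cmul (3 ^ 6) q \<in> aug_power 4"
    by (simp add: q_def gr_mult_linear frag_cmul_diff_right)
  have d: "frag_cmul (3 ^ 6) (minus_one d) \<in> aug_power 4"
    "frag_cmul (3 ^ 6) (minus_one d - q) \<in> aug_power 5"
    using minus_one_commutator_approx[OF ec(3,2) q[unfolded q_def]] by (simp_all add: d_def q_def)

  have "frag_cmul (3 ^ 6) (minus_one d) \<star> x 0 \<in> aug_power 6"
    "x 0 \<star> frag_cmul (3 ^ 6) (minus_one d) \<in> aug_power 6"
    using aug_power_mult[OF d(1) x0] aug_power_mult[OF x0 d(1)] by simp_all
  then have "frag_cmul (3 ^ 6) t \<in> aug_power 6"
    unfolding t_def using aug_power_diff by (fastforce simp: gr_mult_linear frag_cmul_diff_right)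
  then have w: "frag_cmul (3 ^ 6) (minus_one w - t) \<in> aug_power 7"
    using minus_one_commutator_approx(2)[OF dc ec(1), of "3 ^ 6" 6] by (simp add: w_def t_def)

  \<comment> \<open>Replace the inner group commutator \<open>d - 1\<close> by the ring commutator \<open>q\<close>.\<close>
  have "frag_cmul (3 ^ 6) (minus_one d - q) \<star> x 0 \<in> aug_power 7"
    "x 0 \<star> frag_cmul (3 ^ 6) (minus_one d - q) \<in> aug_power 7"
    using aug_power_mult[OF d(2) x0] aug_power_mult[OF x0 d(2)] by simp_all
  then have "frag_cmul (3 ^ 6) (minus_one w - t) + (frag_cmul (3 ^ 6) (minus_one d - q) \<star> x 0
      - x 0 \<star> frag_cmul (3 ^ 6) (minus_one d - q)) \<in> aug_power 7"
    by (intro aug_power_add aug_power_diff w)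
  moreover have "frag_cmul (3 ^ 6) (minus_one w - t) + (frag_cmul (3 ^ 6) (minus_one d - q) \<star> x 0
      - x 0 \<star> frag_cmul (3 ^ 6) (minus_one d - q))
      = frag_cmul (3 ^ 6) (minus_one w - (q \<star> x 0 - x 0 \<star> q))"
    by (simp add: t_def gr_mult_linear frag_cmul_diff_right del: minus_frag_cmul)
  ultimately have "frag_cmul (3 ^ 6) (minus_one w - (q \<star> x 0 - x 0 \<star> q)) \<in> aug_power 7"
    by (simp only:)
  then have "frag_cmul (3 ^ 3) (frag_cmul (3 ^ 6) (minus_one w - (q \<star> x 0 - x 0 \<star> q))) \<in> aug_power 7"
    by (rule aug_power_cmul)
  then have "frag_cmul (3 ^ 9) (minus_one w) - frag_cmul (3 ^ 9) (q \<star> x 0 - x 0 \<star> q) \<in> aug_power 7"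
    by (simp add: frag_cmul_diff_right)
  moreover have "frag_cmul (3 ^ 9) (q \<star> x 0 - x 0 \<star> q) \<in> aug_power 7"
  proof -
    have "x 0 \<star> q = x 0 \<star> x 2 \<star> x 1 - x 0 \<star> x 1 \<star> x 2"
      using ec by (simp add: q_def gr_mult_linear R.m_assoc minus_one_carrier)
    then have "frag_cmul (3 ^ 9) (q \<star> x 0 - x 0 \<star> q)
        = (word 2 1 0 - word 0 2 1) + (word 0 1 2 - word 1 2 0)"
      by (simp add: q_def word_def gr_mult_linear frag_cmul_diff_right)
    then show ?thesis using aug_power_add[OF word_rotate] by simp
  qed
  ultimately have w9: "frag_cmul (3 ^ 9) (minus_one w) \<in> aug_power 7"
    using aug_power_add by fastforce

  \<comment> \<open>The power \<open>w ^ 3^9\<close> is linear in \<open>w - 1\<close> up to \<open>(w - 1)\<^sup>2\<close>, which lies in \<open>\<varpi>\<^sup>8\<close>.\<close>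
  have "minus_one d \<in> aug_power 2"
    using minus_one_commutator_aug_power[OF ec(3,2) x_aug_power x_aug_power]
    by (simp add: d_def numeral_2_eq_2)
  then have "minus_one w \<in> aug_power 4"
    using minus_one_commutator_aug_power[OF dc ec(1) _ x0] by (fastforce simp: w_def)
  then have "minus_one (w [^] ((3::nat) ^ 9)) - frag_cmul (int (3 ^ 9)) (minus_one w) \<in> aug_power (2 * 4)"
    by (rule minus_one_nat_pow_approx[OF wc])
  then have "minus_one (w [^] ((3::nat) ^ 9)) - frag_cmul (3 ^ 9) (minus_one w) \<in> aug_power 7"
    using aug_power_antimono[of _ 8 7] by simp
  from aug_power_add[OF this w9] have "minus_one (w [^] ((3::nat) ^ 9)) \<in> aug_power 7"
    by (simp only: diff_add_cancel)
  then show ?thesis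
    using wc unfolding dimension_subgroup_iff w_def d_def by blast
qed

end

section \<open>The presented group\<close>

lemma hom_commutator:
  assumes "group_hom G H h" "a \<in> carrier G" "b \<in> carrier G"
  shows "h (commutator G a b) = commutator H (h a) (h b)"
proof -
  interpret group_hom G H h by fact
  show ?thesis using assms(2,3) by (simp add: commutator_def)
qed

theorem proposition9p2:
  defines "G \<equiv> presented_group gens rels"
  defines "e \<equiv> (\<lambda>i. presented_gen gens rels (E i))"
  defines "\<omega> \<equiv> commutator G (commutator G (e 2) (e 1)) (e 0) [^]\<^bsub>G\<^esub> ((3::nat) ^ 9)"
  shows "\<omega> \<in> dimension_subgroup 7 G"
proof -
  let ?F = "free_group gens" and ?N = "normal_closure (free_group gens) (relators gens rels)"
  define \<pi> where "\<pi> = (\<lambda>a. ?N #>\<^bsub>?F\<^esub> a)"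
  define f where "f = (\<lambda>c. \<pi> (free_gen gens c))"
  interpret F: group ?F by (rule group_free_group)
  interpret G: group G unfolding G_def by (rule group_presented_group[OF rels_closed])
  interpret N: normal ?N ?F
    by (intro normal_normal_closure group_free_group relators_closed rels_closed)
  have \<pi>: "group_hom ?F G \<pi>"
    using N.r_coset_hom_Mod G.group_axioms F.group_axioms
    by (simp add: group_hom_def group_hom_axioms_def \<pi>_def G_def presented_group_def)
  interpret \<pi>: group_hom ?F G \<pi> by (rule \<pi>)
  have rel: "\<pi> l = \<pi> r" if "(l, r) \<in> rels" for l r
    unfolding \<pi>_def by (rule presented_group_relation[OF rels_closed that])
  have e: "e i = f (E i)" for i
    by (simp add: e_def f_def \<pi>_def presented_gen_def)
  have gen: "free_gen gens c \<in> carrier ?F" if "c \<in> gens" for c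
    using that by (rule free_gen_closed)
  then have fc: "f c \<in> carrier G" if "c \<in> gens" for c
    using that by (simp add: f_def)
  have gen1: "E i \<in> gens" "A i \<in> gens" "B i \<in> gens" if "i \<le> 3" for i
    using that by (auto simp: gens_def)
  have gen2: "U i j \<in> gens" "V i j \<in> gens" "W i j \<in> gens" if "i < j" "j \<le> 3" for i j
    using that by (auto simp: gens_def)
  have rel1: "f (E i) [^]\<^bsub>G\<^esub> ((3::nat) ^ (2 * i)) = commutator G (f (A i)) (f (B i))"
    if i: "i \<le> 3" for i
  proof -
    have "(free_gen gens (E i) [^]\<^bsub>?F\<^esub> ((3::nat) ^ (2 * i)),
        commutator ?F (free_gen gens (A i)) (free_gen gens (B i))) \<in> rels"
    proof -
      have "i \<in> {0, 1, 2, 3}" using i by auto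
      then show ?thesis unfolding rels_def Let_def by blast
    qed
    from rel[OF this] show ?thesis
      using gen1[OF i] gen by (simp add: f_def hom_commutator[OF \<pi>] \<pi>.hom_nat_pow)
  qed
  have rel2: "f (E j) [^]\<^bsub>G\<^esub> ((3::nat) ^ (12 - i)) \<otimes>\<^bsub>G\<^esub> f (E i) [^]\<^bsub>G\<^esub> ((3::nat) ^ (12 - j))
      = commutator G (commutator G (f (U i j)) (f (V i j))) (f (W i j)) [^]\<^bsub>G\<^esub> ((3::nat) ^ (12 - 2 * i - 2 * j))"
    if ij: "(i, j) \<in> {(0, 1), (0, 2), (1, 3), (2, 3)}" for i j
  proof -
    have "(free_gen gens (E j) [^]\<^bsub>?F\<^esub> ((3::nat) ^ (12 - i)) \<otimes>\<^bsub>?F\<^esub> free_gen gens (E i) [^]\<^bsub>?F\<^esub> ((3::nat) ^ (12 - j)),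
        commutator ?F (commutator ?F (free_gen gens (U i j)) (free_gen gens (V i j)))
          (free_gen gens (W i j)) [^]\<^bsub>?F\<^esub> ((3::nat) ^ (12 - 2 * i - 2 * j))) \<in> rels"
      using ij unfolding rels_def Let_def by blast
    note rel[OF this]
    moreover have ij': "i < j" "i \<le> 3" "j \<le> 3" using ij by auto
    moreover note gen[OF gen1(1)[OF ij'(2)]] gen[OF gen1(1)[OF ij'(3)]]
      gen[OF gen2(1)[OF ij'(1,3)]] gen[OF gen2(2)[OF ij'(1,3)]] gen[OF gen2(3)[OF ij'(1,3)]]
    ultimately show ?thesis
      by (simp add: f_def hom_commutator[OF \<pi>] \<pi>.hom_nat_pow commutator_closed[OF group_free_group])
  qed
  have in1: "G.minus_one (f c) \<in> G.aug_power 1" if "c \<in> gens" for c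
    by (intro G.minus_one_aug_power_1 fc that)
  interpret four_cycle_relations G e
  proof unfold_locales
    fix i :: nat assume i: "i \<le> 3"
    show "e i \<in> carrier G" using fc gen1[OF i] by (simp add: e)
    then have "G.minus_one (e i [^]\<^bsub>G\<^esub> ((3::nat) ^ (2 * i))) - frag_cmul (int (3 ^ (2 * i))) (G.minus_one (e i))
        \<in> G.aug_power (2 * 1)"
      by (intro G.minus_one_nat_pow_approx G.minus_one_aug_power_1)
    moreover have "G.minus_one (e i [^]\<^bsub>G\<^esub> ((3::nat) ^ (2 * i))) \<in> G.aug_power (1 + 1)"
      unfolding e rel1[OF i]
      by (intro G.minus_one_commutator_aug_power fc in1 gen1 i)
    ultimately show "frag_cmul (3 ^ (2 * i)) (G.minus_one (e i)) \<in> G.aug_power 2"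
      using G.aug_power_diff by (fastforce simp: numeral_2_eq_2)
  next
    fix i j :: nat assume ij: "(i, j) \<in> {(0, 1), (0, 2), (1, 3), (2, 3)}"
    let ?y = "commutator G (commutator G (f (U i j)) (f (V i j))) (f (W i j))"
    have ij': "i < j" "j \<le> 3" using ij by auto
    have "?y \<in> carrier G"
      by (intro commutator_closed G.group_axioms fc gen2 ij')
    moreover have "G.minus_one ?y \<in> G.aug_power (1 + 1 + 1)"
      by (intro G.minus_one_commutator_aug_power commutator_closed G.group_axioms fc in1 gen2 ij')
    ultimately show "\<exists>y\<in>carrier G. G.minus_one y \<in> G.aug_power 3 \<and>
        e j [^]\<^bsub>G\<^esub> ((3::nat) ^ (12 - i)) \<otimes>\<^bsub>G\<^esub> e i [^]\<^bsub>G\<^esub> ((3::nat) ^ (12 - j))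
          = y [^]\<^bsub>G\<^esub> ((3::nat) ^ (12 - 2 * i - 2 * j))"
      unfolding e rel2[OF ij] by (intro bexI[of _ ?y]) (simp_all add: numeral_3_eq_3)
  qed
  show ?thesis
    unfolding \<omega>_def by (rule triple_commutator_in_dimension_subgroup)
qed

end
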